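(* Let $d,m\ge 1$ be integers and let $\omega=(\omega_1,\dots,\omega_m)$ with $\omega_k\in\mathbb{R}^d$ be the parameters of a checkered regression model, with posterior probabilities $p_\omega(0\mid x)=\Xi_m(\omega_1^\top x,\dots,\omega_m^\top x)$ and $p_\omega(1\mid x)=1-p_\omega(0\mid x)$. Let $x,x'\in\mathbb{R}^d$ be such that $\omega_k^\top x\ne 0$ and $\omega_k^\top x'\ne 0$ for all $1\le k\le m$. Then the following two conditions are equivalent: (i) $\operatorname{sign}\left(p_\omega(0\mid x)-\tfrac12\right)=\operatorname{sign}\left(p_\omega(0\mid x')-\tfrac12\right)$; (ii) the Hamming distance $\sum_{k=1}^m\mathbb{I}\left\{\operatorname{sign}(\omega_k^\top x)\ne\operatorname{sign}(\omega_k^\top x')\right\}$ is even.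
   Context: For an integer $m\ge1$, the checkoid function $\Xi_m:\mathbb{R}^m\to(0,1)$ is defined by $$\Xi_m(z_1,\dots,z_m)=\frac12\left(1+\prod_{k=1}^m\tanh\left(\frac{z_k}{2}\right)\right).$$ $\mathbb{I}\{\cdot\}$ denotes the indicator (1 if the condition holds, 0 otherwise). *)

theory Defs
  imports "HOL-Analysis.Analysis" "HOL-Library.Z2"
begin

(* The dimensions d and m are the cardinalities of finite index types 'd and 'm,
   hence arbitrary and at least 1. *)

definition checkoid :: "real ^ 'm \<Rightarrow> real" where
  "checkoid z = 1 / 2 * (1 + (\<Prod>k\<in>UNIV. tanh (z $ k / 2)))"

(* Row k of w is the parameter vector w_k; the type bit has exactly the two class labels
   0 and 1, and posterior w y x is p_w(y | x). *)

definition posterior :: "real ^ 'd ^ 'm \<Rightarrow> bit \<Rightarrow> real ^ 'd \<Rightarrow> real" where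
  "posterior w y x =
    (if y = 0 then checkoid (\<chi> k. w $ k \<bullet> x) else 1 - checkoid (\<chi> k. w $ k \<bullet> x))"

end

theory Submission
  imports Defs
begin

text \<open>
  The sign of \<open>p(0 | x) - 1/2\<close> is the product of the signs of the \<open>\<omega>\<^sub>k \<bullet> x\<close>, since \<open>tanh\<close>
  preserves signs. Each index at which the nonzero signs for \<open>x\<close> and \<open>x'\<close> differ
  contributes a factor \<open>-1\<close> to the quotient of the two products.
\<close>

lemma sgn_prod_real:
  fixes f :: "'a \<Rightarrow> real"
  shows "sgn (\<Prod>i\<in>A. f i) = (\<Prod>i\<in>A. sgn (f i))"
  by (induction A rule: infinite_finite_induct) (simp_all add: sgn_mult)

lemma sgn_tanh_real: "sgn (tanh x) = sgn (x :: real)"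
  by (cases x "0 :: real" rule: linorder_cases) simp_all

lemma sgn_posterior_0:
  "sgn (posterior w 0 x - 1 / 2) = (\<Prod>k\<in>UNIV. sgn (w $ k \<bullet> x))"
proof -
  have "posterior w 0 x - 1 / 2 = 1 / 2 * (\<Prod>k\<in>UNIV. tanh (w $ k \<bullet> x / 2))"
    by (simp add: posterior_def checkoid_def algebra_simps)
  also have "sgn \<dots> = (\<Prod>k\<in>UNIV. sgn (tanh (w $ k \<bullet> x / 2)))"
    by (simp add: sgn_mult sgn_prod_real)
  \<comment> \<open>Halving the argument of \<open>tanh\<close> is division by a positive number and
    keeps its sign.\<close>
  also have "\<dots> = (\<Prod>k\<in>UNIV. sgn (w $ k \<bullet> x))"
    by (simp add: sgn_tanh_real sgn_divide)
  finally show ?thesis .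
qed

lemma prod_sgn_eq_iff_even:
  fixes f g :: "'a \<Rightarrow> real"
  assumes "\<And>i. i \<in> A \<Longrightarrow> f i \<noteq> 0" and "\<And>i. i \<in> A \<Longrightarrow> g i \<noteq> 0"
  shows "(\<Prod>i\<in>A. sgn (f i)) = (\<Prod>i\<in>A. sgn (g i)) \<longleftrightarrow>
    even (\<Sum>i\<in>A. of_bool (sgn (f i) \<noteq> sgn (g i)) :: nat)" (is "_ \<longleftrightarrow> even ?n")
proof -
  \<comment> \<open>Both signs are 1 or -1, so unequal ones are negatives of each other. Writing the
    factor as a power of -1 makes the exponents add up to \<open>?n\<close>.\<close>
  have "sgn (f i) = (- 1) ^ of_bool (sgn (f i) \<noteq> sgn (g i)) * sgn (g i)" if "i \<in> A" for i
    using assms[OF that] by (auto simp: sgn_if)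
  then have "(\<Prod>i\<in>A. sgn (f i)) =
      (\<Prod>i\<in>A. (- 1) ^ of_bool (sgn (f i) \<noteq> sgn (g i)) * sgn (g i))"
    by (rule prod.cong[OF refl])
  also have "\<dots> = (- 1) ^ ?n * (\<Prod>i\<in>A. sgn (g i))"
    by (simp only: prod.distrib power_sum)
  finally have eq: "(\<Prod>i\<in>A. sgn (f i)) = (- 1) ^ ?n * (\<Prod>i\<in>A. sgn (g i))" .
  \<comment> \<open>Over an infinite \<open>A\<close> the product is 1 by default, hence the case
    split.\<close>
  have "(\<Prod>i\<in>A. sgn (g i)) \<noteq> 0"
    using assms(2) by (cases "finite A") (auto simp: sgn_zero_iff)
  \<comment> \<open>With P the product for \<open>g\<close>, an odd \<open>?n\<close> turns the
    equality into -P = P, which fails for nonzero P.\<close>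
  then show ?thesis
    unfolding eq by (cases "even ?n") simp_all
qed

theorem proposition5p2:
  fixes w :: "real ^ 'd ^ 'm" and x x' :: "real ^ 'd"
  assumes "\<And>k. w $ k \<bullet> x \<noteq> 0" and "\<And>k. w $ k \<bullet> x' \<noteq> 0"
  shows "sgn (posterior w 0 x - 1 / 2) = sgn (posterior w 0 x' - 1 / 2) \<longleftrightarrow>
    even (\<Sum>k\<in>UNIV. of_bool (sgn (w $ k \<bullet> x) \<noteq> sgn (w $ k \<bullet> x')) :: nat)"
  unfolding sgn_posterior_0 using assms by (rule prod_sgn_eq_iff_even)

end
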